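(* Let $\mathbb{F}$ be a field, $E=\mathbb{F}^n$, and let $\Delta=(E,\mathcal{F})$ be a $q$-$\Delta$-matroid. Let $\mathcal{F}_U$ be the set of those elements of $\mathcal{F}$ that have the maximum dimension among the elements of $\mathcal{F}$, and let $\mathcal{F}_L$ be the set of those elements of $\mathcal{F}$ that have the minimum dimension among the elements of $\mathcal{F}$. Then $\mathcal{F}_U$ is the family of bases of a $q$-matroid on $E$, and $\mathcal{F}_L$ is the family of bases of a $q$-matroid on $E$.
   Context: $E=\mathbb{F}^n$ is a finite-dimensional vector space over a field $\mathbb{F}$. A $q$-matroid on $E$ is a pair $M=(E,r)$ with $r$ an integer-valued function on the subspaces of $E$ such that (R1) $0\le r(A)\le\dim A$ for every subspace $A$; (R2) $r(A)\le r(B)$ whenever $A\subseteq B$; (R3) $r(A+B)+r(A\cap B)\le r(A)+r(B)$ for all subspaces $A,B$. A subspace $A$ is independent if $r(A)=\dim A$; a basis is an inclusion-maximal independent subspace. Equivalently (known from earlier literature), a family $\mathcal{B}$ of subspaces of $E$ is the family of bases of a $q$-matroid iff: (B1) $\mathcal{B}\neq\emptyset$; (B2) for $B_1,B_2\in\mathcal{B}$, $B_1\subseteq B_2$ implies $B_1=B_2$; (nB3) for all $B_1,B_2\in\mathcal{B}$ and each subspace $A$ of codimension $1$ in $B_1$ there is $X\subseteq E$ of codimension $1$ in $E$ with $A\subseteq X$, $B_2\not\subseteq X$ and $A+x\in\mathcal{B}$ for all $1$-dimensional $x\subseteq E$, $x\not\subseteq X$. A $q$-$\Delta$-matroid is a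 pair $(E,\mathcal{F})$ with $\mathcal{F}$ a non-empty family of subspaces of $E$ satisfying: (F1) For all $X,Y\in\mathcal{F}$ and each subspace $A$ of codimension $1$ in $X$, either (i) there is a codimension-$1$ subspace $Z\subseteq E$ with $A\subseteq Z$, $Y\not\subseteq Z$, such that $A+z\in\mathcal{F}$ for all $1$-dimensional $z\subseteq E$ with $z\not\subseteq Z$; or (ii) there is a codimension-$1$ subspace $Z\subseteq E$ such that $Z\cap A\in\mathcal{F}$. (F2) For all $X,Y\in\mathcal{F}$ and each subspace $A\subseteq E$ in which $X$ has codimension $1$, either (iii) there is a $1$-dimensional $z\subseteq A$, $z\not\subseteq Y$, such that $A\cap Z\in\mathcal{F}$ for every codimension-$1$ subspace $Z\subseteq E$ with $z\not\subseteq Z$; or (iv) there is a $1$-dimensional $z\subseteq E$ such that $A+z\in\mathcal{F}$. *)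

theory Defs
  imports HOL.Vector_Spaces "HOL-Library.Set_Algebras"
begin

text \<open>
  The ground space \<open>E\<close> is the whole type \<open>UNIV :: 'b set\<close>, a vector space over the field
  \<open>'a\<close> with scalar multiplication \<open>scale\<close>. The coordinate space over a field is the instance
  \<open>vec\<close> of \<open>finite_dimensional_vector_space\<close> in HOL-Analysis. The notions below are meant for
  finite-dimensional spaces, where \<open>dim\<close> is the true dimension. Between subspaces,
  \<open>A + B\<close> is the elementwise sum of sets, hence the sum of subspaces.
\<close>

context vector_space
begin

definition codim1_in :: "'b set \<Rightarrow> 'b set \<Rightarrow> bool" where
  "codim1_in A X \<longleftrightarrow> subspace A \<and> subspace X \<and> A \<subseteq> X \<and> dim X = dim A + 1"

definition one_dim :: "'b set \<Rightarrow> bool" where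
  "one_dim z \<longleftrightarrow> subspace z \<and> dim z = 1"

text \<open>Only the values of \<open>r\<close> on subspaces are relevant.\<close>

definition q_matroid :: "('b set \<Rightarrow> int) \<Rightarrow> bool" where
  "q_matroid r \<longleftrightarrow>
     (\<forall>A. subspace A \<longrightarrow> 0 \<le> r A \<and> r A \<le> int (dim A)) \<and>
     (\<forall>A B. subspace A \<longrightarrow> subspace B \<longrightarrow> A \<subseteq> B \<longrightarrow> r A \<le> r B) \<and>
     (\<forall>A B. subspace A \<longrightarrow> subspace B \<longrightarrow> r (A + B) + r (A \<inter> B) \<le> r A + r B)"

definition q_indep :: "('b set \<Rightarrow> int) \<Rightarrow> 'b set \<Rightarrow> bool" where
  "q_indep r A \<longleftrightarrow> subspace A \<and> r A = int (dim A)"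

definition q_bases :: "('b set \<Rightarrow> int) \<Rightarrow> 'b set set" where
  "q_bases r = {B. q_indep r B \<and> (\<forall>A. q_indep r A \<longrightarrow> B \<subseteq> A \<longrightarrow> A = B)}"

definition q_delta_F1 :: "'b set set \<Rightarrow> bool" where
  "q_delta_F1 \<F> \<longleftrightarrow>
     (\<forall>X\<in>\<F>. \<forall>Y\<in>\<F>. \<forall>A. codim1_in A X \<longrightarrow>
        (\<exists>Z. codim1_in Z UNIV \<and> A \<subseteq> Z \<and> \<not> Y \<subseteq> Z \<and>
             (\<forall>z. one_dim z \<longrightarrow> \<not> z \<subseteq> Z \<longrightarrow> A + z \<in> \<F>)) \<or>
        (\<exists>Z. codim1_in Z UNIV \<and> Z \<inter> A \<in> \<F>))"

definition q_delta_F2 :: "'b set set \<Rightarrow> bool" where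
  "q_delta_F2 \<F> \<longleftrightarrow>
     (\<forall>X\<in>\<F>. \<forall>Y\<in>\<F>. \<forall>A. codim1_in X A \<longrightarrow>
        (\<exists>z. one_dim z \<and> z \<subseteq> A \<and> \<not> z \<subseteq> Y \<and>
             (\<forall>Z. codim1_in Z UNIV \<longrightarrow> \<not> z \<subseteq> Z \<longrightarrow> A \<inter> Z \<in> \<F>)) \<or>
        (\<exists>z. one_dim z \<and> A + z \<in> \<F>))"

definition q_delta_matroid :: "'b set set \<Rightarrow> bool" where
  "q_delta_matroid \<F> \<longleftrightarrow>
     \<F> \<noteq> {} \<and> (\<forall>X\<in>\<F>. subspace X) \<and> q_delta_F1 \<F> \<and> q_delta_F2 \<F>"

definition max_dim_members :: "'b set set \<Rightarrow> 'b set set" where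
  "max_dim_members \<F> = {X \<in> \<F>. \<forall>Y\<in>\<F>. dim Y \<le> dim X}"

definition min_dim_members :: "'b set set \<Rightarrow> 'b set set" where
  "min_dim_members \<F> = {X \<in> \<F>. \<forall>Y\<in>\<F>. dim X \<le> dim Y}"

end

end

theory Submission
  imports Defs
begin

text \<open>
  For members of minimum dimension alternative (ii) of (F1) is impossible, so they satisfy the
  basis exchange property (nB3). For members of maximum dimension alternative (iv) of (F2) is
  impossible, so they satisfy the image of (nB3) under order reversal. That exchange of
  equidimensional subspaces makes \<open>r A = max dim (A \<inter> B)\<close>, over bases \<open>B\<close>, submodular is
  proved for graded modular lattices that stand for both the subspace lattice and its
  opposite. Exchange gives augmentation, and if adding \<open>w\<close> does not raise the rank of \<open>p\<close>, then
  it does not raise the rank of any \<open>q \<ge> p\<close>: exchanging out of a basis a part of \<open>q + w\<close> outside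
  \<open>q\<close>, one could put in its place an atom of \<open>q\<close> or of \<open>w\<close>. For submodularity, apply this to an
  independent \<open>J \<subseteq> C\<close> of full rank that contains an independent subspace of full rank in
  \<open>A \<inter> C\<close>.
\<close>

section \<open>Graded modular lattices\<close>

text \<open>Carrier, order, operations and grade are explicit parameters, because the same sets of
  vectors have to be ordered both by inclusion and by reverse inclusion. The last two axioms supply
  the atoms that are inserted and the coatoms from which an exchange starts.\<close>

locale graded_modular_lattice =
  fixes L :: "'l set"
    and le :: "'l \<Rightarrow> 'l \<Rightarrow> bool" (infix "\<sqsubseteq>" 50)
    and join :: "'l \<Rightarrow> 'l \<Rightarrow> 'l" (infixl "\<squnion>" 65)
    and meet :: "'l \<Rightarrow> 'l \<Rightarrow> 'l" (infixl "\<sqinter>" 70)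
    and d :: "'l \<Rightarrow> nat"
  assumes refl: "a \<in> L \<Longrightarrow> a \<sqsubseteq> a"
    and trans: "a \<in> L \<Longrightarrow> b \<in> L \<Longrightarrow> c \<in> L \<Longrightarrow> a \<sqsubseteq> b \<Longrightarrow> b \<sqsubseteq> c \<Longrightarrow> a \<sqsubseteq> c"
    and join_closed [simp]: "a \<in> L \<Longrightarrow> b \<in> L \<Longrightarrow> a \<squnion> b \<in> L"
    and meet_closed [simp]: "a \<in> L \<Longrightarrow> b \<in> L \<Longrightarrow> a \<sqinter> b \<in> L"
    and join_iff: "a \<in> L \<Longrightarrow> b \<in> L \<Longrightarrow> c \<in> L \<Longrightarrow> a \<squnion> b \<sqsubseteq> c \<longleftrightarrow> a \<sqsubseteq> c \<and> b \<sqsubseteq> c"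
    and meet_iff: "a \<in> L \<Longrightarrow> b \<in> L \<Longrightarrow> c \<in> L \<Longrightarrow> c \<sqsubseteq> a \<sqinter> b \<longleftrightarrow> c \<sqsubseteq> a \<and> c \<sqsubseteq> b"
    and modular: "a \<in> L \<Longrightarrow> b \<in> L \<Longrightarrow> d (a \<squnion> b) + d (a \<sqinter> b) = d a + d b"
    and d_mono: "a \<in> L \<Longrightarrow> b \<in> L \<Longrightarrow> a \<sqsubseteq> b \<Longrightarrow> d a \<le> d b"
    and d_strict: "a \<in> L \<Longrightarrow> b \<in> L \<Longrightarrow> a \<sqsubseteq> b \<Longrightarrow> \<not> b \<sqsubseteq> a \<Longrightarrow> d a < d b"
    and atom_below: "a \<in> L \<Longrightarrow> b \<in> L \<Longrightarrow> \<not> a \<sqsubseteq> b \<Longrightarrow>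
      \<exists>x\<in>L. d x = 1 \<and> x \<sqsubseteq> a \<and> \<not> x \<sqsubseteq> b"
    and coatom_avoiding: "u \<in> L \<Longrightarrow> b \<in> L \<Longrightarrow> x \<in> L \<Longrightarrow> u \<sqsubseteq> b \<Longrightarrow> x \<sqsubseteq> b \<Longrightarrow> \<not> x \<sqsubseteq> u \<Longrightarrow>
      \<exists>a\<in>L. u \<sqsubseteq> a \<and> a \<sqsubseteq> b \<and> d b = d a + 1 \<and> \<not> x \<sqsubseteq> a"
begin

lemma le_join [simp]:
  assumes "a \<in> L" "b \<in> L"
  shows "a \<sqsubseteq> a \<squnion> b" "b \<sqsubseteq> a \<squnion> b"
  using join_iff[of a b "a \<squnion> b"] refl assms by auto

lemma meet_le [simp]:
  assumes "a \<in> L" "b \<in> L"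
  shows "a \<sqinter> b \<sqsubseteq> a" "a \<sqinter> b \<sqsubseteq> b"
  using meet_iff[of a b "a \<sqinter> b"] refl assms by auto

lemma d_less_join:
  assumes "a \<in> L" "b \<in> L" "\<not> b \<sqsubseteq> a"
  shows "d a < d (a \<squnion> b)"
  using assms by (intro d_strict) (auto simp: join_iff)

end

section \<open>Exchange and submodularity of the rank\<close>

text \<open>\<open>exchange\<close> is (nB3) with atoms as 1-dimensional spaces.
  \<open>rank_upper\<close> and \<open>rank_attained\<close> pin \<open>r a\<close> down as a
  maximum without prescribing a formula, so each interpretation can bring its own.\<close>

locale lattice_bases = graded_modular_lattice +
  fixes \<B> :: "'a set" and k :: nat and r :: "'a \<Rightarrow> nat"
  assumes bases_sub: "\<B> \<subseteq> L"
    and d_basis: "b \<in> \<B> \<Longrightarrow> d b = k"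
    and exchange: "x \<in> \<B> \<Longrightarrow> y \<in> \<B> \<Longrightarrow> a \<in> L \<Longrightarrow> a \<sqsubseteq> x \<Longrightarrow> d x = d a + 1 \<Longrightarrow>
      \<exists>z\<in>L. a \<sqsubseteq> z \<and> \<not> y \<sqsubseteq> z \<and> (\<forall>p\<in>L. d p = 1 \<longrightarrow> \<not> p \<sqsubseteq> z \<longrightarrow> a \<squnion> p \<in> \<B>)"
    and rank_upper: "a \<in> L \<Longrightarrow> b \<in> \<B> \<Longrightarrow> d (a \<sqinter> b) \<le> r a"
    and rank_attained: "a \<in> L \<Longrightarrow> \<exists>b\<in>\<B>. d (a \<sqinter> b) = r a"
begin

lemma basis_in [simp]: "b \<in> \<B> \<Longrightarrow> b \<in> L"
  using bases_sub by auto

text \<open>Elements below some basis play the role of independent subspaces; this is how they bound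
  a rank from below.\<close>

lemma rank_lower:
  assumes "i \<in> L" "a \<in> L" "b \<in> \<B>" "i \<sqsubseteq> a" "i \<sqsubseteq> b"
  shows "d i \<le> r a"
  using d_mono[of i "a \<sqinter> b"] rank_upper[of a b] assms by (simp add: meet_iff)

lemma rank_mono:
  assumes "a \<in> L" "b \<in> L" "a \<sqsubseteq> b"
  shows "r a \<le> r b"
proof -
  obtain x where x: "x \<in> \<B>" "d (a \<sqinter> x) = r a"
    using rank_attained assms by blast
  have "a \<sqinter> x \<sqsubseteq> b"
    using trans[of "a \<sqinter> x" a b] x assms by simp
  then show ?thesis
    using rank_lower[of "a \<sqinter> x" b x] x assms by simp
qed

text \<open>An element \<open>?m\<close> that realizes the rank of \<open>b\<close> meets
  \<open>a\<close> in grade at most \<open>r a\<close>, and by the modular law this meet loses at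
  most \<open>d b - d a\<close>.\<close>

lemma rank_increase:
  assumes "a \<in> L" "b \<in> L" "a \<sqsubseteq> b"
  shows "r b + d a \<le> r a + d b"
proof -
  obtain x where x: "x \<in> \<B>" "d (b \<sqinter> x) = r b"
    using rank_attained assms by blast
  let ?m = "b \<sqinter> x"
  have "a \<sqinter> ?m \<sqsubseteq> x"
    using trans[of "a \<sqinter> ?m" ?m x] x assms by simp
  then have "d (a \<sqinter> ?m) \<le> r a"
    using rank_lower[of "a \<sqinter> ?m" a x] x assms by simp
  moreover have "d (a \<squnion> ?m) \<le> d b"
    using x assms by (intro d_mono) (simp_all add: join_iff)
  ultimately show ?thesis
    using modular[of a ?m] x assms by simp
qed

text \<open>Apply \<open>exchange\<close> to a coatom \<open>a\<close> of \<open>x\<close> that lies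
  above \<open>u\<close> but not above \<open>v\<close>. Any \<open>w\<close> not below the
  resulting \<open>z\<close> has an atom outside \<open>z\<close>, which joined to \<open>a\<close>
  gives a basis.\<close>

lemma strong_exchange:
  assumes "x \<in> \<B>" "y \<in> \<B>" "u \<in> L" "v \<in> L" "u \<sqsubseteq> x" "v \<sqsubseteq> x" "\<not> v \<sqsubseteq> u"
  obtains z where "z \<in> L" "u \<sqsubseteq> z" "\<not> y \<sqsubseteq> z" "v \<sqsubseteq> z \<Longrightarrow> x \<sqsubseteq> z"
    "\<And>w. w \<in> L \<Longrightarrow> \<not> w \<sqsubseteq> z \<Longrightarrow>
      \<exists>p\<in>L. \<exists>x'\<in>\<B>. p \<sqsubseteq> w \<and> \<not> p \<sqsubseteq> z \<and> u \<sqsubseteq> x' \<and> p \<sqsubseteq> x'"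
proof -
  obtain a where a: "a \<in> L" "u \<sqsubseteq> a" "a \<sqsubseteq> x" "d x = d a + 1" "\<not> v \<sqsubseteq> a"
    using coatom_avoiding[of u x v] assms by auto
  obtain z where z: "z \<in> L" "a \<sqsubseteq> z" "\<not> y \<sqsubseteq> z"
    and ex: "\<forall>p\<in>L. d p = 1 \<longrightarrow> \<not> p \<sqsubseteq> z \<longrightarrow> a \<squnion> p \<in> \<B>"
    using exchange[of x y a] assms a by auto
  show thesis
  proof
    show "z \<in> L" "\<not> y \<sqsubseteq> z" by fact+
    show "u \<sqsubseteq> z"
      using trans[of u a z] a z assms by simp
    show "x \<sqsubseteq> z" if "v \<sqsubseteq> z"
    proof -
      have "a \<squnion> v \<sqsubseteq> x" "a \<squnion> v \<sqsubseteq> z"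
        using that a z assms by (simp_all add: join_iff)
      \<comment> \<open>The grade of \<open>a \<squnion> v\<close> exceeds
        \<open>d a = d x - 1\<close>, which leaves no room strictly below \<open>x\<close>.\<close>
      moreover have "x \<sqsubseteq> a \<squnion> v"
        using d_strict[of "a \<squnion> v" x] d_less_join[of a v] calculation a assms by fastforce
      ultimately show ?thesis
        using trans[of x "a \<squnion> v" z] a z assms by simp
    qed
    show "\<exists>p\<in>L. \<exists>x'\<in>\<B>. p \<sqsubseteq> w \<and> \<not> p \<sqsubseteq> z \<and> u \<sqsubseteq> x' \<and> p \<sqsubseteq> x'"
      if w: "w \<in> L" "\<not> w \<sqsubseteq> z" for w
    proof -
      obtain p where p: "p \<in> L" "d p = 1" "p \<sqsubseteq> w" "\<not> p \<sqsubseteq> z"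
        using atom_below[of w z] w z by auto
      have "u \<sqsubseteq> a \<squnion> p"
        using trans[of u a "a \<squnion> p"] a p assms by simp
      then show ?thesis
        using p ex a by (intro bexI[of _ p] bexI[of _ "a \<squnion> p"]) auto
    qed
  qed
qed

text \<open>Among the bases above \<open>i\<close>, one whose meet with \<open>c\<close> has
  greatest grade works. If it gained nothing from \<open>j\<close>, either a count of grades
  contradicts \<open>d i < d j\<close>, or a further exchange towards \<open>c\<close> enlarges the
  meet.\<close>

lemma augment:
  assumes "i \<in> L" "j \<in> L" "b \<in> \<B>" "c \<in> \<B>" "i \<sqsubseteq> b" "j \<sqsubseteq> c" "d i < d j"
  obtains x where "x \<in> \<B>" "i \<sqsubseteq> x" "\<not> j \<sqinter> x \<sqsubseteq> i"
proof -
  have "d (y \<sqinter> c) \<le> k" if "y \<in> \<B>" for y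
    using d_mono[of "y \<sqinter> c" y] d_basis[of y] that assms by simp
  then have "\<exists>x. (x \<in> \<B> \<and> i \<sqsubseteq> x) \<and> (\<forall>y. y \<in> \<B> \<and> i \<sqsubseteq> y \<longrightarrow> d (y \<sqinter> c) \<le> d (x \<sqinter> c))"
    using assms by (intro ex_has_greatest_nat[of _ b _ "Suc k"]) (auto simp: less_Suc_eq_le)
  then obtain x where x: "x \<in> \<B>" "i \<sqsubseteq> x"
    and max: "\<And>y. y \<in> \<B> \<Longrightarrow> i \<sqsubseteq> y \<Longrightarrow> d (y \<sqinter> c) \<le> d (x \<sqinter> c)"
    by blast
  have "\<not> j \<sqinter> x \<sqsubseteq> i"
  proof
    assume ji: "j \<sqinter> x \<sqsubseteq> i"
    let ?m = "x \<sqinter> c"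
    let ?u = "i \<squnion> ?m"
    have u: "?u \<sqsubseteq> x"
      using x assms by (simp add: join_iff)
    show False
    proof (cases "x \<sqsubseteq> ?u")
      \<comment> \<open>Now \<open>i\<close> and \<open>?m\<close> fill the basis \<open>x\<close>,
        so \<open>d (i \<squnion> ?m)\<close> is at least \<open>k\<close>, while \<open>j\<close>
        and \<open>?m\<close> both lie below \<open>c\<close>. As \<open>j \<sqinter> ?m\<close>
        lies below \<open>i\<close>, the modular law for both pairs yields
        \<open>d j \<le> d i\<close>.\<close>
      case True
      then have "k \<le> d ?u"
        using d_mono[of x ?u] d_basis[of x] x assms by simp
      moreover have "d (j \<squnion> ?m) \<le> k"
        using d_mono[of "j \<squnion> ?m" c] d_basis[of c] x assms by (simp add: join_iff)
      moreover have "d (j \<sqinter> ?m) \<le> d (i \<sqinter> ?m)"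
      proof (rule d_mono)
        have "j \<sqinter> ?m \<sqsubseteq> x"
          using trans[of "j \<sqinter> ?m" ?m x] x assms by simp
        then have "j \<sqinter> ?m \<sqsubseteq> j \<sqinter> x"
          using x assms by (simp add: meet_iff)
        then show "j \<sqinter> ?m \<sqsubseteq> i \<sqinter> ?m"
          using trans[of "j \<sqinter> ?m" "j \<sqinter> x" i] ji x assms
          by (simp add: meet_iff[of i ?m])
      qed (use x assms in simp_all)
      ultimately show False
        using modular[of i ?m] modular[of j ?m] x assms by simp
    next
      case False
      \<comment> \<open>Keeping \<open>?u\<close> preserves both \<open>i\<close> and the old meet
        \<open>?m\<close>. The atom put in is taken below \<open>c\<close> and outside
        \<open>z\<close>, hence outside \<open>?m\<close>, so the meet with \<open>c\<close>
        grows.\<close>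
      obtain z where z: "z \<in> L" "?u \<sqsubseteq> z" "\<not> c \<sqsubseteq> z"
        and ex: "\<And>w. w \<in> L \<Longrightarrow> \<not> w \<sqsubseteq> z \<Longrightarrow>
          \<exists>p\<in>L. \<exists>x'\<in>\<B>. p \<sqsubseteq> w \<and> \<not> p \<sqsubseteq> z \<and> ?u \<sqsubseteq> x' \<and> p \<sqsubseteq> x'"
        using strong_exchange[of x c ?u x] False u x assms by (auto simp: refl)
      obtain p x' where p: "p \<in> L" "x' \<in> \<B>" "p \<sqsubseteq> c" "\<not> p \<sqsubseteq> z" "?u \<sqsubseteq> x'" "p \<sqsubseteq> x'"
        using ex[of c] z assms by auto
      have sub: "i \<sqsubseteq> x'" "?m \<sqsubseteq> x'" "?m \<sqsubseteq> z"
        using p z x assms by (simp_all add: join_iff)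
      then have "\<not> p \<sqsubseteq> ?m"
        using trans[of p ?m z] p z x assms by auto
      then have "d ?m < d (?m \<squnion> p)"
        using d_less_join p x assms by simp
      also have "\<dots> \<le> d (x' \<sqinter> c)"
        using sub p x assms by (intro d_mono) (simp_all add: join_iff meet_iff)
      finally show False
        using max[of x'] p sub by simp
    qed
  qed
  then show thesis using that x by blast
qed

text \<open>Take a basis above \<open>i\<close> with greatest meet with \<open>a\<close>. Were this
  meet below the rank, augmenting it from a meet \<open>a \<sqinter> c\<close> of full rank would
  give a better basis, still above \<open>i\<close>.\<close>

lemma extend:
  assumes "i \<in> L" "a \<in> L" "b \<in> \<B>" "i \<sqsubseteq> b" "i \<sqsubseteq> a"
  obtains x where "x \<in> \<B>" "i \<sqsubseteq> x" "d (a \<sqinter> x) = r a"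
proof -
  have "\<exists>x. (x \<in> \<B> \<and> i \<sqsubseteq> x) \<and> (\<forall>y. y \<in> \<B> \<and> i \<sqsubseteq> y \<longrightarrow> d (a \<sqinter> y) \<le> d (a \<sqinter> x))"
    using assms by (intro ex_has_greatest_nat[of _ b _ "Suc (r a)"])
      (auto simp: less_Suc_eq_le intro!: rank_upper)
  then obtain x where x: "x \<in> \<B>" "i \<sqsubseteq> x"
    and max: "\<And>y. y \<in> \<B> \<Longrightarrow> i \<sqsubseteq> y \<Longrightarrow> d (a \<sqinter> y) \<le> d (a \<sqinter> x)"
    by blast
  have "\<not> d (a \<sqinter> x) < r a"
  proof
    assume less: "d (a \<sqinter> x) < r a"
    obtain c where c: "c \<in> \<B>" "d (a \<sqinter> c) = r a"
      using rank_attained assms by blast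
    obtain y where y: "y \<in> \<B>" "a \<sqinter> x \<sqsubseteq> y" "\<not> a \<sqinter> c \<sqinter> y \<sqsubseteq> a \<sqinter> x"
      using augment[of "a \<sqinter> x" "a \<sqinter> c" x c] less c x assms by auto
    let ?p = "a \<sqinter> c \<sqinter> y"
    have "i \<sqsubseteq> a \<sqinter> x"
      using x assms by (simp add: meet_iff)
    then have p: "?p \<sqsubseteq> a" "?p \<sqsubseteq> y" "i \<sqsubseteq> y"
      using trans[of ?p "a \<sqinter> c" a] trans[of i "a \<sqinter> x" y] x c y assms by simp_all
    have "d (a \<sqinter> x) < d (a \<sqinter> x \<squnion> ?p)"
      using d_less_join x c y assms by simp
    also have "\<dots> \<le> d (a \<sqinter> y)"
      using p x c y assms by (intro d_mono) (simp_all add: join_iff meet_iff[of a y])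
    finally show False
      using max[of y] y p by simp
  qed
  then show thesis
    using that x rank_upper[of a x] assms by force
qed

text \<open>If the rank of \<open>q\<close> rose, some basis \<open>b\<close> above a full-rank part
  \<open>?u\<close> of \<open>q\<close> would contain a further part \<open>?v\<close> of
  \<open>q \<squnion> w\<close>. Exchanging out of \<open>b\<close> then makes room for an atom of
  \<open>q\<close> or of \<open>w\<close>, and either choice exceeds a known rank.\<close>

lemma rank_join_eq_mono:
  assumes "p \<in> L" "q \<in> L" "w \<in> L" "p \<sqsubseteq> q" "r (p \<squnion> w) = r p"
  shows "r (q \<squnion> w) = r q"
proof (rule ccontr)
  assume "r (q \<squnion> w) \<noteq> r q"
  then have less: "r q < r (q \<squnion> w)"
    using rank_mono[of q "q \<squnion> w"] assms by simp
  obtain b0 where b0: "b0 \<in> \<B>" "d (p \<sqinter> b0) = r p"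
    using rank_attained assms by blast
  let ?i = "p \<sqinter> b0"
  have i: "?i \<in> L" "?i \<sqsubseteq> p" "?i \<sqsubseteq> q"
    using trans[of ?i p q] b0 assms by simp_all
  \<comment> \<open>Extending \<open>?i\<close>, instead of taking any basis that attains the rank
    of \<open>q\<close>, puts \<open>?i\<close> below \<open>?u\<close>. An atom that fits with
    \<open>?u\<close> then fits with \<open>?i\<close> as well.\<close>
  obtain b1 where b1: "b1 \<in> \<B>" "?i \<sqsubseteq> b1" "d (q \<sqinter> b1) = r q"
    using extend[of ?i q b0] i b0 assms by auto
  obtain c where c: "c \<in> \<B>" "d ((q \<squnion> w) \<sqinter> c) = r (q \<squnion> w)"
    using rank_attained[of "q \<squnion> w"] assms by auto
  let ?u = "q \<sqinter> b1" and ?j = "(q \<squnion> w) \<sqinter> c"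
  obtain b where b: "b \<in> \<B>" "?u \<sqsubseteq> b" "\<not> ?j \<sqinter> b \<sqsubseteq> ?u"
    using augment[of ?u ?j b1 c] less b1 c assms by auto
  let ?v = "?j \<sqinter> b"
  have v: "?v \<in> L" "?v \<sqsubseteq> b" "?v \<sqsubseteq> q \<squnion> w"
    using trans[of ?v ?j "q \<squnion> w"] b c assms by simp_all
  have u: "?u \<in> L" "?u \<sqsubseteq> q" "?i \<sqsubseteq> ?u"
    using i b1 assms by (simp_all add: meet_iff[of q b1])
  \<comment> \<open>Exchanging \<open>b\<close> against itself gives a \<open>z\<close> that is not
    above \<open>b\<close>, and therefore not above \<open>?v\<close> either.\<close>
  obtain z where z: "z \<in> L" "?u \<sqsubseteq> z" "\<not> b \<sqsubseteq> z" "?v \<sqsubseteq> z \<Longrightarrow> b \<sqsubseteq> z"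
    and ex: "\<And>w. w \<in> L \<Longrightarrow> \<not> w \<sqsubseteq> z \<Longrightarrow>
      \<exists>p\<in>L. \<exists>x'\<in>\<B>. p \<sqsubseteq> w \<and> \<not> p \<sqsubseteq> z \<and> ?u \<sqsubseteq> x' \<and> p \<sqsubseteq> x'"
    using strong_exchange[of b b ?u ?v] b u v by auto
  \<comment> \<open>An atom below \<open>t\<close> can be adjoined to any part of \<open>?u\<close> within a basis.\<close>
  have raise: "\<exists>e\<in>L. e \<sqsubseteq> t \<and> d s < d (s \<squnion> e) \<and> d (s \<squnion> e) \<le> r (g \<squnion> t)"
    if st: "t \<in> L" "\<not> t \<sqsubseteq> z" "s \<in> L" "s \<sqsubseteq> ?u" "g \<in> L" "s \<sqsubseteq> g" for s t g
  proof -
    obtain e y where e: "e \<in> L" "y \<in> \<B>" "e \<sqsubseteq> t" "\<not> e \<sqsubseteq> z" "?u \<sqsubseteq> y" "e \<sqsubseteq> y"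
      using ex[of t] st by auto
    have "s \<sqsubseteq> y" "s \<sqsubseteq> z" "s \<sqsubseteq> g \<squnion> t" "e \<sqsubseteq> g \<squnion> t"
      using trans[of s ?u y] trans[of s ?u z] trans[of s g "g \<squnion> t"] trans[of e t "g \<squnion> t"]
        that e u z by simp_all
    moreover from this have "\<not> e \<sqsubseteq> s"
      using trans[of e s z] e z that by auto
    ultimately show ?thesis
      using d_less_join[of s e] rank_lower[of "s \<squnion> e" "g \<squnion> t" y] e that
      by (intro bexI[of _ e]) (simp_all add: join_iff)
  qed
  have "\<not> q \<squnion> w \<sqsubseteq> z"
    using trans[of ?v "q \<squnion> w" z] v z assms by auto
  then consider "\<not> q \<sqsubseteq> z" | "\<not> w \<sqsubseteq> z"
    using z assms by (auto simp: join_iff)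
  then show False
  proof cases
    \<comment> \<open>An atom of \<open>q\<close> would raise \<open>?u\<close>, whose grade is
      already \<open>r q\<close>, inside \<open>q\<close>.\<close>
    case 1
    have "r (q \<squnion> q) \<le> r q"
      using rank_mono[of "q \<squnion> q" q] assms by (simp add: join_iff refl)
    then show False
      using raise[of q ?u q] 1 u assms b1 refl by force
  next
    \<comment> \<open>An atom of \<open>w\<close> would raise \<open>?i\<close>, of grade
      \<open>r p\<close>, inside \<open>p \<squnion> w\<close>, whose rank is also
      \<open>r p\<close>.\<close>
    case 2
    then show False
      using raise[of w ?i p] i u assms b0 by force
  qed
qed

text \<open>Joining \<open>c\<close> to \<open>?j\<close> leaves the rank at \<open>r c\<close>, so
  \<open>r (a \<squnion> c)\<close> is at most \<open>r (a \<squnion> ?j)\<close>. This exceeds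
  \<open>r a\<close> by at most
  \<open>d (a \<squnion> ?j) - d a = d ?j - d (a \<sqinter> ?j)\<close>, where
  \<open>d ?j = r c\<close> and \<open>a \<sqinter> ?j\<close> lies above \<open>?i\<close>, of
  grade \<open>r ?m\<close>.\<close>

theorem rank_submodular:
  assumes "a \<in> L" "c \<in> L"
  shows "r (a \<squnion> c) + r (a \<sqinter> c) \<le> r a + r c"
proof -
  let ?m = "a \<sqinter> c"
  obtain b0 where b0: "b0 \<in> \<B>" "d (?m \<sqinter> b0) = r ?m"
    using rank_attained[of ?m] assms by auto
  let ?i = "?m \<sqinter> b0"
  have i: "?i \<in> L" "?i \<sqsubseteq> a" "?i \<sqsubseteq> c" "?i \<sqsubseteq> b0"
    using trans[of ?i ?m a] trans[of ?i ?m c] assms b0 by simp_all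
  obtain b where b: "b \<in> \<B>" "?i \<sqsubseteq> b" "d (c \<sqinter> b) = r c"
    using extend[of ?i c b0] i b0 assms by auto
  let ?j = "c \<sqinter> b"
  have j: "?j \<in> L" "?j \<sqsubseteq> c" "?j \<sqsubseteq> b"
    using b assms by simp_all
  have "r ?j = r c"
    using rank_lower[of ?j ?j b] rank_mono[of ?j c] b j assms refl by simp
  moreover have "r (?j \<squnion> c) = r c"
    using rank_mono[of "?j \<squnion> c" c] rank_mono[of c "?j \<squnion> c"] j assms
    by (simp add: join_iff refl)
  ultimately have "r (a \<squnion> ?j \<squnion> c) = r (a \<squnion> ?j)"
    using rank_join_eq_mono[of ?j "a \<squnion> ?j" c] j assms by simp
  moreover have "r (a \<squnion> c) \<le> r (a \<squnion> ?j \<squnion> c)"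
    using trans[of a "a \<squnion> ?j" "a \<squnion> ?j \<squnion> c"] j assms
    by (intro rank_mono) (simp_all add: join_iff[of a c])
  moreover have "r (a \<squnion> ?j) + d a \<le> r a + d (a \<squnion> ?j)"
    using rank_increase[of a "a \<squnion> ?j"] j assms by simp
  moreover have "d ?i \<le> d (a \<sqinter> ?j)"
    using i b j assms by (intro d_mono) (simp_all add: meet_iff[of a ?j] meet_iff[of c b])
  ultimately show ?thesis
    using modular[of a ?j] j assms b b0 by simp
qed

end

section \<open>The subspace lattice and its opposite\<close>

context finite_dimensional_vector_space
begin

lemma set_plus_eq_sums: "A + B = {x + y |x y. x \<in> A \<and> y \<in> B}"
  by (auto simp: set_plus_def)

lemma subspace_plus:
  "subspace A \<Longrightarrow> subspace B \<Longrightarrow> subspace (A + B)"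
  unfolding set_plus_eq_sums by (rule subspace_sums)

lemma dim_plus_Int:
  "subspace A \<Longrightarrow> subspace B \<Longrightarrow> dim (A + B) + dim (A \<inter> B) = dim A + dim B"
  unfolding set_plus_eq_sums by (rule dim_sums_Int)

lemma plus_subset_iff:
  assumes "subspace A" "subspace B" "subspace C"
  shows "A + B \<subseteq> C \<longleftrightarrow> A \<subseteq> C \<and> B \<subseteq> C"
proof
  assume *: "A + B \<subseteq> C"
  show "A \<subseteq> C \<and> B \<subseteq> C"
    using * set_plus_intro[of _ A 0 B] set_plus_intro[of 0 A _ B] assms[THEN subspace_0] by auto
next
  assume "A \<subseteq> C \<and> B \<subseteq> C"
  then show "A + B \<subseteq> C"
    using subspace_add[OF assms(3)] by (auto elim!: set_plus_elim)
qed

lemma subspace_dim_strict_mono: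
  "subspace A \<Longrightarrow> subspace B \<Longrightarrow> A \<subset> B \<Longrightarrow> dim A < dim B"
  using subspace_dim_equal[of A B] by (auto simp: not_le[symmetric])

text \<open>Extend a basis of \<open>U\<close> by \<open>v\<close> and then to a basis of
  \<open>B\<close>; the span of all of it except \<open>v\<close> is the required subspace.\<close>

lemma ex_hyperplane_avoiding:
  assumes "subspace U" "subspace B" "U \<subseteq> B" "v \<in> B" "v \<notin> U"
  obtains A where "subspace A" "U \<subseteq> A" "A \<subseteq> B" "dim B = dim A + 1" "v \<notin> A"
proof -
  obtain S where S: "S \<subseteq> U" "independent S" "U \<subseteq> span S"
    using maximal_independent_subset by blast
  have "span S = U"
    using S assms span_minimal by blast
  then have "independent (insert v S)"
    using S assms by (simp add: independent_insert)
  then obtain T where T: "insert v S \<subseteq> T" "T \<subseteq> B" "independent T" "B \<subseteq> span T"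
    using maximal_independent_subset_extend[of "insert v S" B] S assms by blast
  let ?A = "span (T - {v})"
  have v: "v \<notin> ?A"
    using T dependent_def by auto
  have "v \<notin> S"
    using S assms by blast
  then have "U \<subseteq> ?A"
    using \<open>span S = U\<close> T span_mono[of S "T - {v}"] by blast
  moreover have "?A \<subseteq> B"
    using T assms by (intro span_minimal) auto
  moreover have "dim B = dim ?A + 1"
  proof -
    have "dim B = dim T"
      using T basis_card_eq_dim[of T B] dim_eq_card_independent[of T] by simp
    moreover have "insert v (T - {v}) = T"
      using T by blast
    ultimately show ?thesis
      using v dim_insert[of v "T - {v}"] by simp
  qed
  ultimately show thesis
    using that[of ?A] v by simp
qed

lemma subspace_lattice:
  "graded_modular_lattice {A. subspace A} (\<subseteq>) (+) (\<inter>) dim"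
proof
  fix A B :: "'b set"
  assume AB: "A \<in> {A. subspace A}" "B \<in> {A. subspace A}"
  show "A + B \<in> {A. subspace A}" "A \<inter> B \<in> {A. subspace A}"
    using AB by (simp_all add: subspace_plus subspace_inter)
  show "dim (A + B) + dim (A \<inter> B) = dim A + dim B"
    using AB by (simp add: dim_plus_Int)
  show "dim A < dim B" if "A \<subseteq> B" "\<not> B \<subseteq> A"
    using AB that by (intro subspace_dim_strict_mono) auto
  show "\<exists>x\<in>{A. subspace A}. dim x = 1 \<and> x \<subseteq> A \<and> \<not> x \<subseteq> B" if nsub: "\<not> A \<subseteq> B"
  proof -
    obtain v where v: "v \<in> A" "v \<notin> B"
      using nsub by blast
    then have "v \<noteq> 0"
      using AB subspace_0 by auto
    then show ?thesis
      using v AB span_base[of v "{v}"] span_minimal[of "{v}" A] by (intro bexI[of _ "span {v}"]) auto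
  qed
next
  fix U B x
  assume sub: "U \<in> {A. subspace A}" "B \<in> {A. subspace A}" "x \<in> {A. subspace A}"
    and *: "U \<subseteq> B" "x \<subseteq> B" "\<not> x \<subseteq> U"
  then obtain v where "v \<in> x" "v \<notin> U" "v \<in> B"
    by blast
  then show "\<exists>a\<in>{A. subspace A}. U \<subseteq> a \<and> a \<subseteq> B \<and> dim B = dim a + 1 \<and> \<not> x \<subseteq> a"
    using ex_hyperplane_avoiding[of U B v] sub * by (metis mem_Collect_eq subsetD)
qed (auto simp: plus_subset_iff dim_subset)

text \<open>The grade is the codimension. Atoms are now hyperplanes of the whole space, and an
  element one step above \<open>B\<close> is avoided through a single vector added to
  \<open>B\<close>.\<close>

lemma dual_subspace_lattice:
  "graded_modular_lattice {A. subspace A} (\<lambda>A B. B \<subseteq> A) (\<inter>) (+) (\<lambda>A. dimension - dim A)"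
proof
  fix A B :: "'b set"
  assume AB: "A \<in> {A. subspace A}" "B \<in> {A. subspace A}"
  show "A + B \<in> {A. subspace A}" "A \<inter> B \<in> {A. subspace A}"
    using AB by (simp_all add: subspace_plus subspace_inter)
  show "dimension - dim (A \<inter> B) + (dimension - dim (A + B)) = dimension - dim A + (dimension - dim B)"
    using AB dim_plus_Int[of A B] dim_subset_UNIV[of A] dim_subset_UNIV[of B]
      dim_subset_UNIV[of "A + B"] dim_subset_UNIV[of "A \<inter> B"] by simp
  show "dimension - dim A < dimension - dim B" if "B \<subseteq> A" "\<not> A \<subseteq> B"
    using AB that subspace_dim_strict_mono[of B A] dim_subset_UNIV[of A] by fastforce
  show "\<exists>x\<in>{A. subspace A}. dimension - dim x = 1 \<and> A \<subseteq> x \<and> \<not> B \<subseteq> x" if nsub: "\<not> B \<subseteq> A"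
  proof -
    obtain v where v: "v \<in> B" "v \<notin> A"
      using nsub by blast
    obtain H where "subspace H" "A \<subseteq> H" "dim (UNIV :: 'b set) = dim H + 1" "v \<notin> H"
      using ex_hyperplane_avoiding[of A UNIV v] v AB by auto
    then show ?thesis
      using v by (intro bexI[of _ H]) (auto simp: dimension_def)
  qed
next
  fix U B x
  assume sub: "U \<in> {A. subspace A}" "B \<in> {A. subspace A}" "x \<in> {A. subspace A}"
    and *: "B \<subseteq> U" "B \<subseteq> x" "\<not> U \<subseteq> x"
  then obtain v where v: "v \<in> U" "v \<notin> x" "v \<notin> B"
    by blast
  let ?A = "span (insert v B)"
  have "?A \<subseteq> U"
    using v sub * by (intro span_minimal) auto
  moreover have "insert v B \<subseteq> ?A"
    by (rule span_superset)
  moreover have "dim ?A = dim B + 1"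
    using v sub by (simp add: dim_insert span_eq_iff[THEN iffD2])
  ultimately show "\<exists>a\<in>{A. subspace A}. a \<subseteq> U \<and> B \<subseteq> a \<and>
      dimension - dim B = dimension - dim a + 1 \<and> \<not> a \<subseteq> x"
    using v dim_subset_UNIV[of ?A] by (intro bexI[of _ ?A]) auto
qed (auto simp: plus_subset_iff dim_subset diff_le_mono2)

section \<open>From exchange properties to q-matroids\<close>

text \<open>Over an infinite field \<open>\<B>\<close> may be infinite, but the dimensions are
  bounded by \<open>dim A\<close>, so \<open>Max\<close> is meaningful for nonempty
  \<open>\<B>\<close>.\<close>

definition q_rank :: "'b set set \<Rightarrow> 'b set \<Rightarrow> nat" where
  "q_rank \<B> A = Max ((\<lambda>B. dim (A \<inter> B)) ` \<B>)"

lemma finite_dim_Int: "finite ((\<lambda>B. dim (A \<inter> B)) ` \<B>)"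
  by (rule finite_subset[of _ "{..dim A}"]) (auto intro: dim_subset)

lemma q_rank_upper: "B \<in> \<B> \<Longrightarrow> dim (A \<inter> B) \<le> q_rank \<B> A"
  unfolding q_rank_def by (intro Max_ge finite_dim_Int) auto

lemma q_rank_attained:
  assumes "\<B> \<noteq> {}"
  obtains B where "B \<in> \<B>" "dim (A \<inter> B) = q_rank \<B> A"
  using Max_in[OF finite_dim_Int[of A \<B>]] assms unfolding q_rank_def by force

text \<open>A subspace has full rank exactly when it lies in a member of \<open>\<B>\<close>. Since
  all members have the same dimension, they are the maximal such subspaces.\<close>

lemma q_matroid_q_rank:
  assumes "\<B> \<noteq> {}" and bases: "\<And>B. B \<in> \<B> \<Longrightarrow> subspace B \<and> dim B = k"
    and submod: "\<And>A B. subspace A \<Longrightarrow> subspace B \<Longrightarrow>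
      q_rank \<B> (A + B) + q_rank \<B> (A \<inter> B) \<le> q_rank \<B> A + q_rank \<B> B"
  shows "\<exists>r. q_matroid r \<and> q_bases r = \<B>"
proof (intro exI conjI)
  let ?r = "\<lambda>A. int (q_rank \<B> A)"
  have le_dim: "q_rank \<B> A \<le> dim A" for A
    using q_rank_attained[OF assms(1), of A] dim_subset[of "A \<inter> _" A] by (metis Int_lower1)
  have mono: "q_rank \<B> A \<le> q_rank \<B> B" if "A \<subseteq> B" for A B
  proof -
    obtain C where C: "C \<in> \<B>" "dim (A \<inter> C) = q_rank \<B> A"
      using q_rank_attained assms by blast
    have "dim (A \<inter> C) \<le> dim (B \<inter> C)"
      using that by (intro dim_subset) auto
    then show ?thesis
      using q_rank_upper[of C \<B> B] C by simp
  qed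
  show "q_matroid ?r"
    using le_dim mono submod by (auto simp: q_matroid_def simp flip: of_nat_add)
  have indep: "q_indep ?r A \<longleftrightarrow> subspace A \<and> (\<exists>B\<in>\<B>. A \<subseteq> B)" for A
  proof
    assume *: "q_indep ?r A"
    obtain B where B: "B \<in> \<B>" "dim (A \<inter> B) = q_rank \<B> A"
      using q_rank_attained assms by blast
    then have "A \<inter> B = A"
      using * bases[of B] by (intro subspace_dim_equal) (auto simp: q_indep_def subspace_inter)
    then show "subspace A \<and> (\<exists>B\<in>\<B>. A \<subseteq> B)"
      using B * by (auto simp: q_indep_def)
  next
    assume *: "subspace A \<and> (\<exists>B\<in>\<B>. A \<subseteq> B)"
    then obtain B where "B \<in> \<B>" "A \<inter> B = A"
      by blast
    then show "q_indep ?r A"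
      using * q_rank_upper[of B \<B> A] le_dim[of A] by (simp add: q_indep_def)
  qed
  show "q_bases ?r = \<B>"
  proof (intro set_eqI iffI)
    fix B
    assume "B \<in> q_bases ?r"
    then show "B \<in> \<B>"
      unfolding q_bases_def indep using bases by blast
  next
    fix B
    assume B: "B \<in> \<B>"
    have "A = B" if A: "subspace A" "C \<in> \<B>" "A \<subseteq> C" "B \<subseteq> A" for A C
      using subspace_dim_equal[of B A] dim_subset[of A C] A B bases by auto
    then show "B \<in> q_bases ?r"
      unfolding q_bases_def indep using B bases by blast
  qed
qed

lemma q_matroid_of_exchange:
  assumes "\<B> \<noteq> {}" and bases: "\<And>B. B \<in> \<B> \<Longrightarrow> subspace B \<and> dim B = k"
    and exch: "\<And>X Y A. X \<in> \<B> \<Longrightarrow> Y \<in> \<B> \<Longrightarrow> codim1_in A X \<Longrightarrow>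
      \<exists>Z. codim1_in Z UNIV \<and> A \<subseteq> Z \<and> \<not> Y \<subseteq> Z \<and>
        (\<forall>z. one_dim z \<longrightarrow> \<not> z \<subseteq> Z \<longrightarrow> A + z \<in> \<B>)"
  shows "\<exists>r. q_matroid r \<and> q_bases r = \<B>"
proof -
  interpret graded_modular_lattice "{A. subspace A}" "(\<subseteq>)" "(+)" "(\<inter>)" dim
    by (rule subspace_lattice)
  interpret lattice_bases "{A. subspace A}" "(\<subseteq>)" "(+)" "(\<inter>)" dim \<B> k "q_rank \<B>"
  proof
    fix X Y A
    assume "X \<in> \<B>" "Y \<in> \<B>" "A \<in> {A. subspace A}" "A \<subseteq> X" "dim X = dim A + 1"
    then obtain Z where "codim1_in Z UNIV" "A \<subseteq> Z" "\<not> Y \<subseteq> Z"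
      "\<And>z. one_dim z \<Longrightarrow> \<not> z \<subseteq> Z \<Longrightarrow> A + z \<in> \<B>"
      using exch[of X Y A] bases[of X] by (auto simp: codim1_in_def)
    then show "\<exists>z\<in>{A. subspace A}. A \<subseteq> z \<and> \<not> Y \<subseteq> z \<and>
        (\<forall>p\<in>{A. subspace A}. dim p = 1 \<longrightarrow> \<not> p \<subseteq> z \<longrightarrow> A + p \<in> \<B>)"
      by (intro bexI[of _ Z]) (auto simp: codim1_in_def one_dim_def)
  next
    show "\<exists>b\<in>\<B>. dim (A \<inter> b) = q_rank \<B> A" for A
      using q_rank_attained[OF assms(1)] by metis
  qed (use bases q_rank_upper in auto)
  show ?thesis
    using assms(1) bases rank_submodular by (rule q_matroid_q_rank) auto
qed

text \<open>Read in the opposite lattice, the hypothesis is the exchange property with codimension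
  as grade. The rank there differs from \<open>q_rank\<close> only by a constant and a dimension
  term.\<close>

lemma q_matroid_of_dual_exchange:
  assumes "\<B> \<noteq> {}" and bases: "\<And>B. B \<in> \<B> \<Longrightarrow> subspace B \<and> dim B = k"
    and exch: "\<And>X Y A. X \<in> \<B> \<Longrightarrow> Y \<in> \<B> \<Longrightarrow> codim1_in X A \<Longrightarrow>
      \<exists>z. one_dim z \<and> z \<subseteq> A \<and> \<not> z \<subseteq> Y \<and>
        (\<forall>Z. codim1_in Z UNIV \<longrightarrow> \<not> z \<subseteq> Z \<longrightarrow> A \<inter> Z \<in> \<B>)"
  shows "\<exists>r. q_matroid r \<and> q_bases r = \<B>"
proof -
  let ?d = "\<lambda>A. dimension - dim A"
  \<comment> \<open>The rank function of the dual q-matroid, transported along the order reversal.\<close>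
  let ?r = "\<lambda>A. dimension + q_rank \<B> A - k - dim A"
  have k: "dimension + q_rank \<B> A \<ge> k + dim A" if "subspace A" for A
  proof -
    obtain B where "B \<in> \<B>" "dim (A \<inter> B) = q_rank \<B> A"
      using q_rank_attained assms by blast
    then show ?thesis
      using dim_plus_Int[of A B] dim_subset_UNIV[of "A + B"] bases[of B] that by simp
  qed
  \<comment> \<open>For fixed \<open>A\<close> the codimension of the sum increases with the
    dimension of the intersection, so both are maximized by the same members of
    \<open>\<B>\<close>.\<close>
  have codim: "?d (A + B) = dimension + dim (A \<inter> B) - k - dim A" if "subspace A" "B \<in> \<B>" for A B
    using dim_plus_Int[of A B] dim_subset_UNIV[of "A + B"] bases[of B] that by simp
  interpret graded_modular_lattice "{A. subspace A}" "\<lambda>A B. B \<subseteq> A" "(\<inter>)" "(+)" ?d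
    by (rule dual_subspace_lattice)
  interpret lattice_bases "{A. subspace A}" "\<lambda>A B. B \<subseteq> A" "(\<inter>)" "(+)" ?d \<B> "dimension - k" ?r
  proof
    fix X Y A
    assume *: "X \<in> \<B>" "Y \<in> \<B>" "A \<in> {A. subspace A}" "X \<subseteq> A"
      "dimension - dim X = dimension - dim A + 1"
    then have "codim1_in X A"
      using bases[of X] dim_subset_UNIV[of A] by (auto simp: codim1_in_def)
    then obtain z where "one_dim z" "z \<subseteq> A" "\<not> z \<subseteq> Y"
      and z: "\<And>Z. codim1_in Z UNIV \<Longrightarrow> \<not> z \<subseteq> Z \<Longrightarrow> A \<inter> Z \<in> \<B>"
      using exch[of X Y A] * by blast
    moreover have "codim1_in p UNIV" if "subspace p" "dimension - dim p = 1" for p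
      using that by (auto simp: codim1_in_def dimension_def)
    ultimately show "\<exists>z\<in>{A. subspace A}. z \<subseteq> A \<and> \<not> z \<subseteq> Y \<and>
        (\<forall>p\<in>{A. subspace A}. dimension - dim p = 1 \<longrightarrow> \<not> z \<subseteq> p \<longrightarrow> A \<inter> p \<in> \<B>)"
      by (intro bexI[of _ z]) (auto simp: one_dim_def)
  next
    fix A B
    assume "A \<in> {A. subspace A}" "B \<in> \<B>"
    then show "dimension - dim (A + B) \<le> ?r A"
      using q_rank_upper[of B \<B> A] codim[of A B] by simp
  next
    fix A
    assume "A \<in> {A. subspace A}"
    then show "\<exists>b\<in>\<B>. dimension - dim (A + b) = ?r A"
      using codim[of A] q_rank_attained[OF assms(1), of A] by (metis mem_Collect_eq)
  qed (use bases in auto)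
  show ?thesis
  proof (rule q_matroid_q_rank)
    fix A B
    assume "subspace A" "subspace B"
    \<comment> \<open>The dimension terms cancel by the modular law; \<open>k\<close> ensures that
      no subtraction in \<open>?r\<close> is truncated.\<close>
    then show "q_rank \<B> (A + B) + q_rank \<B> (A \<inter> B) \<le> q_rank \<B> A + q_rank \<B> B"
      using rank_submodular[of A B] k[of A] k[of B] k[of "A + B"] k[of "A \<inter> B"]
        dim_plus_Int[of A B] by (simp add: subspace_plus subspace_inter)
  qed (use assms in auto)
qed

section \<open>Members of extreme dimension in a q-Delta-matroid\<close>

lemma dim_plus_one_dim:
  assumes "subspace A" "one_dim z" "\<not> z \<subseteq> A"
  shows "dim (A + z) = dim A + 1"
proof -
  have z: "subspace z" "dim z = 1"
    using assms by (auto simp: one_dim_def)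
  then have "dim (A \<inter> z) < dim z"
    using subspace_dim_strict_mono[of "A \<inter> z" z] assms by (auto simp: subspace_inter)
  then show ?thesis
    using dim_plus_Int[of A z] z assms by linarith
qed

lemma dim_Int_codim1:
  assumes "subspace A" "codim1_in Z UNIV" "\<not> A \<subseteq> Z"
  shows "dim A = dim (A \<inter> Z) + 1"
proof -
  have Z: "subspace Z" "dimension = dim Z + 1"
    using assms by (auto simp: codim1_in_def dimension_def)
  then have "dim Z < dim (A + Z)"
    using plus_subset_iff[of A Z "A + Z"] plus_subset_iff[of A Z Z] assms
    by (intro subspace_dim_strict_mono) (auto simp: subspace_plus)
  then show ?thesis
    using dim_plus_Int[of A Z] dim_subset_UNIV[of "A + Z"] Z assms by simp
qed

lemma ex_max_dim_member:
  assumes "\<F> \<noteq> {}"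
  shows "max_dim_members \<F> \<noteq> {}"
proof -
  obtain X where "X \<in> \<F>"
    using assms by blast
  then have "\<exists>X. X \<in> \<F> \<and> (\<forall>Y. Y \<in> \<F> \<longrightarrow> dim Y \<le> dim X)"
    by (rule ex_has_greatest_nat[of _ _ _ "Suc dimension"]) (simp add: less_Suc_eq_le dim_subset_UNIV)
  then show ?thesis
    by (auto simp: max_dim_members_def)
qed

lemma ex_min_dim_member:
  assumes "\<F> \<noteq> {}"
  shows "min_dim_members \<F> \<noteq> {}"
proof -
  obtain X where "X \<in> \<F>"
    using assms by blast
  then have "\<exists>X. X \<in> \<F> \<and> (\<forall>Y. Y \<in> \<F> \<longrightarrow> dim X \<le> dim Y)"
    by (rule ex_has_least_nat)
  then show ?thesis
    by (auto simp: min_dim_members_def)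
qed

text \<open>Alternative (iv) would give a member containing \<open>A\<close>, which is already too
  large. In (iii) a hyperplane that misses \<open>z\<close> cuts \<open>A\<close> down by exactly
  one dimension, so the new member is again of maximum dimension.\<close>

lemma q_matroid_max_dim_members:
  assumes "q_delta_matroid \<F>"
  shows "\<exists>r. q_matroid r \<and> q_bases r = max_dim_members \<F>"
proof -
  have \<F>: "\<F> \<noteq> {}" "\<And>X. X \<in> \<F> \<Longrightarrow> subspace X" "q_delta_F2 \<F>"
    using assms by (auto simp: q_delta_matroid_def)
  obtain M where M: "M \<in> max_dim_members \<F>"
    using ex_max_dim_member \<F> by blast
  have in_max: "X \<in> max_dim_members \<F> \<longleftrightarrow> X \<in> \<F> \<and> dim X = dim M" for X
    using M by (force simp: max_dim_members_def)
  show ?thesis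
  proof (rule q_matroid_of_dual_exchange)
    fix X Y A
    assume X: "X \<in> max_dim_members \<F>" and Y: "Y \<in> max_dim_members \<F>" and A: "codim1_in X A"
    have "A + z \<notin> \<F>" if "one_dim z" for z
    proof
      assume "A + z \<in> \<F>"
      then have "dim (A + z) \<le> dim X"
        using X by (simp add: max_dim_members_def)
      moreover have "A \<subseteq> A + z"
        using A that plus_subset_iff[of A z "A + z"]
        by (simp add: subspace_plus codim1_in_def one_dim_def)
      ultimately show False
        using A dim_subset[of A "A + z"] by (simp add: codim1_in_def)
    qed
    then obtain z where z: "one_dim z" "z \<subseteq> A" "\<not> z \<subseteq> Y"
      and in_\<F>: "\<And>Z. codim1_in Z UNIV \<Longrightarrow> \<not> z \<subseteq> Z \<Longrightarrow> A \<inter> Z \<in> \<F>"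
      using \<F>(3) X Y A unfolding q_delta_F2_def in_max by metis
    have "A \<inter> Z \<in> max_dim_members \<F>" if "codim1_in Z UNIV" "\<not> z \<subseteq> Z" for Z
      using dim_Int_codim1[of A Z] in_\<F>[of Z] that z A X by (auto simp: in_max codim1_in_def)
    then show "\<exists>z. one_dim z \<and> z \<subseteq> A \<and> \<not> z \<subseteq> Y \<and>
        (\<forall>Z. codim1_in Z UNIV \<longrightarrow> \<not> z \<subseteq> Z \<longrightarrow> A \<inter> Z \<in> max_dim_members \<F>)"
      using z by blast
  qed (use M \<F>(2) in_max in auto)
qed

text \<open>Alternative (ii) would give a member inside \<open>A\<close>, which is already too
  small. In (i) a line outside \<open>Z\<close> is outside \<open>A\<close>, so adding it restores
  the minimum dimension.\<close>

lemma q_matroid_min_dim_members: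
  assumes "q_delta_matroid \<F>"
  shows "\<exists>r. q_matroid r \<and> q_bases r = min_dim_members \<F>"
proof -
  have \<F>: "\<F> \<noteq> {}" "\<And>X. X \<in> \<F> \<Longrightarrow> subspace X" "q_delta_F1 \<F>"
    using assms by (auto simp: q_delta_matroid_def)
  obtain M where M: "M \<in> min_dim_members \<F>"
    using ex_min_dim_member \<F> by blast
  have in_min: "X \<in> min_dim_members \<F> \<longleftrightarrow> X \<in> \<F> \<and> dim X = dim M" for X
    using M by (force simp: min_dim_members_def)
  show ?thesis
  proof (rule q_matroid_of_exchange)
    fix X Y A
    assume X: "X \<in> min_dim_members \<F>" and Y: "Y \<in> min_dim_members \<F>" and A: "codim1_in A X"
    have "Z \<inter> A \<notin> \<F>" for Z
    proof
      assume "Z \<inter> A \<in> \<F>"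
      then have "dim X \<le> dim (Z \<inter> A)"
        using X by (simp add: min_dim_members_def)
      then show False
        using A dim_subset[of "Z \<inter> A" A] by (simp add: codim1_in_def)
    qed
    then obtain Z where Z: "codim1_in Z UNIV" "A \<subseteq> Z" "\<not> Y \<subseteq> Z"
      and in_\<F>: "\<And>z. one_dim z \<Longrightarrow> \<not> z \<subseteq> Z \<Longrightarrow> A + z \<in> \<F>"
      using \<F>(3) X Y A unfolding q_delta_F1_def in_min by metis
    have "A + z \<in> min_dim_members \<F>" if "one_dim z" "\<not> z \<subseteq> Z" for z
      using dim_plus_one_dim[of A z] in_\<F>[of z] that Z A X by (auto simp: in_min codim1_in_def)
    then show "\<exists>Z. codim1_in Z UNIV \<and> A \<subseteq> Z \<and> \<not> Y \<subseteq> Z \<and>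
        (\<forall>z. one_dim z \<longrightarrow> \<not> z \<subseteq> Z \<longrightarrow> A + z \<in> min_dim_members \<F>)"
      using Z by blast
  qed (use M \<F>(2) in_min in auto)
qed

end

theorem proposition3p6:
  fixes scale :: "'a::field \<Rightarrow> 'b::ab_group_add \<Rightarrow> 'b"
    and Basis :: "'b set"
    and \<F> :: "'b set set"
  assumes "finite_dimensional_vector_space scale Basis"
    and "vector_space.q_delta_matroid scale \<F>"
  shows "(\<exists>r. vector_space.q_matroid scale r \<and>
              vector_space.q_bases scale r = vector_space.max_dim_members scale \<F>) \<and>
         (\<exists>r. vector_space.q_matroid scale r \<and>
              vector_space.q_bases scale r = vector_space.min_dim_members scale \<F>)"
proof -
  interpret finite_dimensional_vector_space scale Basis
    by fact
  show ?thesis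
    using q_matroid_max_dim_members q_matroid_min_dim_members assms(2) by blast
qed

end
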